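(* Let $\Delta$ and $\Delta'$ be connected multi-graphs and let $\phi$ be an isomorphism between the $1$-line graphs $L_1(\Delta)$ and $L_1(\Delta')$. Then there is a unique isomorphism between $\Delta$ and $\Delta'$ inducing $\phi$, unless $\Delta$ or $\Delta'$ has four vertices. Moreover, up to isomorphism, there is a unique connected multi-graph $\Delta''$ whose number of vertices is not four, such that $L_1(\Delta'')$ is isomorphic to $L_1(\Delta)$ and to $L_1(\Delta')$.
   Context: A multi-graph $\Delta=(V,E)$ consists of a set $V$ of vertices, a set $E$ of edges and a relation $\sim$ between $V$ and $E$ such that for every $e\in E$ there are exactly two distinct $v,w\in V$ with $v\sim e$ and $w\sim e$ (the vertices "on" $e$); multiple edges on the same pair of vertices are allowed and the sets may be infinite. Two vertices are adjacent if some edge is on both. Connectedness refers to this adjacency. The $1$-line graph $L_1(\Delta)$ is the (simple) graph with vertex set $E$ in which $e\neq f$ are adjacent iff there is exactly one vertex $v$ with $v\sim e$ and $v\sim f$. An isomorphism between multi-graphs $\Delta=(V,E)$ and $\Delta'=(V',E')$ is a pair of bijections $\phi_V:V\to V'$, $\phi_E:E\to E'$ with $v\sim e\iff\phi_V(v)\sim\phi_E(e)$ for all $v\in V,e\in E$; it induces the isomorphism $\phi_E$ between the line graphs, and "an isomorphism inducing $\phi$" means one with $\phi_E=\phi$.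
   Formalization: Uniqueness of the inducing isomorphism is claimed only when Δ does not have exactly two vertices (swapping the two vertices induces the identity on edges; existence is still claimed), and connected multi-graphs are taken to have at least one vertex. *)

theory Defs
  imports Main "HOL-Library.FuncSet"
begin

record ('v, 'e) multigraph =
  verts :: "'v set"
  edges :: "'e set"
  inc :: "('v \<times> 'e) set"

definition is_multigraph :: "('v, 'e) multigraph \<Rightarrow> bool" where
  "is_multigraph D \<longleftrightarrow> inc D \<subseteq> verts D \<times> edges D \<and>
     (\<forall>e\<in>edges D. \<exists>v w. v \<noteq> w \<and> {u. (u, e) \<in> inc D} = {v, w})"

definition adjacent :: "('v, 'e) multigraph \<Rightarrow> 'v \<Rightarrow> 'v \<Rightarrow> bool" where
  "adjacent D v w \<longleftrightarrow> v \<noteq> w \<and> (\<exists>e\<in>edges D. (v, e) \<in> inc D \<and> (w, e) \<in> inc D)"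

text \<open>The graph without vertices is not regarded as connected: it has the same (empty)
  1-line graph as the graph with a single vertex, to which it is not isomorphic.\<close>

definition connected_multigraph :: "('v, 'e) multigraph \<Rightarrow> bool" where
  "connected_multigraph D \<longleftrightarrow> is_multigraph D \<and> verts D \<noteq> {} \<and>
     (\<forall>v\<in>verts D. \<forall>w\<in>verts D. (adjacent D)\<^sup>*\<^sup>* v w)"

definition multigraph_iso ::
  "('v, 'e) multigraph \<Rightarrow> ('w, 'f) multigraph \<Rightarrow> ('v \<Rightarrow> 'w) \<Rightarrow> ('e \<Rightarrow> 'f) \<Rightarrow> bool" where
  "multigraph_iso D D' fV fE \<longleftrightarrow>
     bij_betw fV (verts D) (verts D') \<and> bij_betw fE (edges D) (edges D') \<and>
     (\<forall>v\<in>verts D. \<forall>e\<in>edges D. (v, e) \<in> inc D \<longleftrightarrow> (fV v, fE e) \<in> inc D')"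

definition multigraph_isomorphic ::
  "('v, 'e) multigraph \<Rightarrow> ('w, 'f) multigraph \<Rightarrow> bool" where
  "multigraph_isomorphic D D' \<longleftrightarrow> (\<exists>fV fE. multigraph_iso D D' fV fE)"

text \<open>A simple graph is given by its vertex set and its symmetric irreflexive adjacency
  relation.\<close>

record 'a sgraph =
  gverts :: "'a set"
  gadj :: "('a \<times> 'a) set"

definition sgraph_iso :: "'a sgraph \<Rightarrow> 'b sgraph \<Rightarrow> ('a \<Rightarrow> 'b) \<Rightarrow> bool" where
  "sgraph_iso G H f \<longleftrightarrow> bij_betw f (gverts G) (gverts H) \<and>
     (\<forall>x\<in>gverts G. \<forall>y\<in>gverts G. (x, y) \<in> gadj G \<longleftrightarrow> (f x, f y) \<in> gadj H)"

definition sgraph_isomorphic :: "'a sgraph \<Rightarrow> 'b sgraph \<Rightarrow> bool" where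
  "sgraph_isomorphic G H \<longleftrightarrow> (\<exists>f. sgraph_iso G H f)"

definition line_graph1 :: "('v, 'e) multigraph \<Rightarrow> 'e sgraph" where
  "line_graph1 D =
     \<lparr> gverts = edges D,
       gadj = {(e, f). e \<in> edges D \<and> f \<in> edges D \<and> e \<noteq> f \<and>
                 (\<exists>!v. (v, e) \<in> inc D \<and> (v, f) \<in> inc D)} \<rparr>"

text \<open>On two vertices every isomorphism can be composed with the swap of the vertices
  without changing the induced map on edges, so uniqueness fails there.\<close>

lemma two_vertices_not_unique:
  assumes "is_multigraph D" and V: "verts D = {a, b}" "a \<noteq> b" and iso: "multigraph_iso D D' fV fE"
  shows "multigraph_iso D D' (fV(a := fV b, b := fV a)) fE"
    and "(fV(a := fV b, b := fV a)) a \<noteq> fV a"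
proof -
  let ?g = "fV(a := fV b, b := fV a)"
  have inc: "(v, e) \<in> inc D" if e: "e \<in> edges D" and v: "v \<in> verts D" for v e
  proof -
    obtain x y where xy: "x \<noteq> y" "{u. (u, e) \<in> inc D} = {x, y}"
      using assms(1) e unfolding is_multigraph_def by metis
    have mem: "(u, e) \<in> inc D \<longleftrightarrow> u = x \<or> u = y" for u
      using xy(2) by (metis insertCI insertE mem_Collect_eq singletonD)
    have "inc D \<subseteq> verts D \<times> edges D"
      using assms(1) by (simp add: is_multigraph_def)
    then have "u \<in> {a, b}" if "(u, e) \<in> inc D" for u
      using that unfolding V(1) by (metis SigmaD1 subsetD)
    then have "x \<in> {a, b}" "y \<in> {a, b}"
      using mem by simp_all
    with xy(1) v have "v = x \<or> v = y"
      unfolding V(1) by (metis insertE singletonD)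
    then show ?thesis using mem by simp
  qed
  have fV: "bij_betw fV {a, b} (verts D')" and fE: "bij_betw fE (edges D) (edges D')"
    and all: "\<forall>v\<in>verts D. \<forall>e\<in>edges D. (fV v, fE e) \<in> inc D'"
    using iso inc unfolding multigraph_iso_def V(1) by metis+
  have img: "verts D' = {fV a, fV b}"
    using bij_betw_imp_surj_on[OF fV] by (metis image_empty image_insert)
  have ne: "fV a \<noteq> fV b"
    using bij_betw_imp_inj_on[OF fV] V(2) by (metis inj_on_def insertCI)
  have "?g ` {a, b} = {fV a, fV b}" "inj_on ?g {a, b}"
    using ne V(2) by (simp_all add: insert_commute)
  then have "bij_betw ?g (verts D) (verts D')"
    unfolding bij_betw_def V(1) img by (rule conjI[rotated])
  moreover have "(?g v, fE e) \<in> inc D'" if "v \<in> verts D" "e \<in> edges D" for v e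
    using all that unfolding V(1) by auto
  ultimately show "multigraph_iso D D' ?g fE"
    unfolding multigraph_iso_def using fE inc by metis
  show "?g a \<noteq> fV a"
    using ne V(2) by simp
qed

end

theory Submission
  imports Defs
begin

text \<open>If the number of vertices is not four, incidence can be read off the 1-line graph. Two
  edges are parallel iff they are non-adjacent with the same neighbours: for disjoint edges, an
  edge leaving their four endpoints separates them. Three pairwise adjacent edges form a claw iff
  some edge is adjacent to an odd number of them: an edge leaving the four vertices of a claw
  meets one or three of its edges, whereas every edge is adjacent to zero or two edges of a
  triangle. Hence the set of edges on a vertex that lies on two non-parallel edges is preserved.
  On four vertices, replacing every edge on a fixed vertex by the complementary pair keeps the
  1-line graph and leaves only three vertices.\<close>

section \<open>Ends of edges and adjacency of edges\<close>

definition ends :: "('v, 'e) multigraph \<Rightarrow> 'e \<Rightarrow> 'v set" where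
  "ends D e = {v. (v, e) \<in> inc D}"

text \<open>Adjacency in the 1-line graph of a multi-graph: that \<open>e\<close> and
  \<open>f\<close> are distinct is implied, as an edge shares two vertices with itself.\<close>

definition meets :: "('v, 'e) multigraph \<Rightarrow> 'e \<Rightarrow> 'e \<Rightarrow> bool" where
  "meets D e f \<longleftrightarrow> e \<in> edges D \<and> f \<in> edges D \<and> (\<exists>!v. v \<in> ends D e \<and> v \<in> ends D f)"

lemma ends_edge:
  assumes "is_multigraph D" "e \<in> edges D"
  obtains v w where "v \<noteq> w" "ends D e = {v, w}" "v \<in> verts D" "w \<in> verts D"
proof -
  obtain v w where vw: "v \<noteq> w" "ends D e = {v, w}"
    using assms unfolding is_multigraph_def ends_def by metis
  then have "(v, e) \<in> inc D" "(w, e) \<in> inc D"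
    unfolding ends_def by auto
  then show thesis
    using assms vw that unfolding is_multigraph_def by blast
qed

lemma ends_subset_verts: "is_multigraph D \<Longrightarrow> ends D e \<subseteq> verts D"
  unfolding is_multigraph_def ends_def by auto

lemma ends_edge_at:
  assumes "is_multigraph D" "e \<in> edges D" "v \<in> ends D e"
  obtains w where "v \<noteq> w" "ends D e = {v, w}" "w \<in> verts D"
proof -
  obtain x y where xy: "x \<noteq> y" "ends D e = {x, y}" "x \<in> verts D" "y \<in> verts D"
    using ends_edge[OF assms(1,2)] by blast
  then consider "v = x" | "v = y"
    using assms(3) by blast
  then show thesis
    using that[of x] that[of y] xy by cases (auto simp: insert_commute)
qed

lemma ends_eq_doubletonI:
  assumes "is_multigraph D" "e \<in> edges D" "v \<in> ends D e" "w \<in> ends D e" "v \<noteq> w"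
  shows "ends D e = {v, w}"
proof -
  obtain u where "ends D e = {v, u}"
    using ends_edge_at[OF assms(1-3)] by blast
  then show ?thesis
    using assms(4,5) by auto
qed

lemma meets_edges: "meets D e f \<Longrightarrow> e \<in> edges D" "meets D e f \<Longrightarrow> f \<in> edges D"
  unfolding meets_def by auto

lemma meets_common_end:
  assumes "meets D e f"
  obtains v where "v \<in> ends D e" "v \<in> ends D f"
  using assms unfolding meets_def by blast

lemma meets_common_end_unique:
  assumes "meets D e f" "v \<in> ends D e" "v \<in> ends D f" "w \<in> ends D e" "w \<in> ends D f"
  shows "v = w"
  using assms unfolding meets_def by metis

lemma meets_doubleton:
  assumes "e \<in> edges D" "f \<in> edges D" "ends D e = {a, b}" "ends D f = {c, d}" "a \<noteq> b" "c \<noteq> d"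
  shows "meets D e f \<longleftrightarrow> {a, b} \<noteq> {c, d} \<and> (a = c \<or> a = d \<or> b = c \<or> b = d)"
  using assms unfolding meets_def by (auto simp: doubleton_eq_iff)

lemma meets_shape:
  assumes "is_multigraph D" "meets D e f"
  obtains v a b where "ends D e = {v, a}" "ends D f = {v, b}" "v \<noteq> a" "v \<noteq> b" "a \<noteq> b"
proof -
  have E: "e \<in> edges D" "f \<in> edges D"
    using assms(2) by (auto dest: meets_edges)
  obtain v where v: "v \<in> ends D e" "v \<in> ends D f"
    using meets_common_end[OF assms(2)] by metis
  obtain a where a: "v \<noteq> a" "ends D e = {v, a}"
    using ends_edge_at[OF assms(1) E(1) v(1)] by metis
  obtain b where b: "v \<noteq> b" "ends D f = {v, b}"
    using ends_edge_at[OF assms(1) E(2) v(2)] by metis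
  have "a \<noteq> b"
    using meets_common_end_unique[OF assms(2), of v a] a b by auto
  with a b that show thesis by metis
qed

lemma meets_if_common_end:
  assumes "is_multigraph D" "e \<in> edges D" "f \<in> edges D" "v \<in> ends D e" "v \<in> ends D f"
    and "ends D e \<noteq> ends D f"
  shows "meets D e f"
proof -
  obtain a where a: "v \<noteq> a" "ends D e = {v, a}"
    using ends_edge_at[OF assms(1,2,4)] by metis
  obtain b where b: "v \<noteq> b" "ends D f = {v, b}"
    using ends_edge_at[OF assms(1,3,5)] by metis
  show ?thesis
    using meets_doubleton[OF assms(2,3) a(2) b(2) a(1) b(1)] a b assms(6) by auto
qed

text \<open>Different sets of two ends that intersect do so in one vertex. In this form, adjacency
  can be computed from explicit sets of ends.\<close>

lemma meets_iff_ends: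
  assumes "is_multigraph D" "e \<in> edges D" "f \<in> edges D"
  shows "meets D e f \<longleftrightarrow> ends D e \<noteq> ends D f \<and> ends D e \<inter> ends D f \<noteq> {}"
proof
  assume "meets D e f"
  then show "ends D e \<noteq> ends D f \<and> ends D e \<inter> ends D f \<noteq> {}"
    by (rule meets_shape[OF assms(1)]) (auto simp: doubleton_eq_iff)
qed (use meets_if_common_end[OF assms] in blast)

lemma gverts_line_graph1 [simp]: "gverts (line_graph1 D) = edges D"
  by (simp add: line_graph1_def)

lemma gadj_line_graph1:
  assumes "is_multigraph D"
  shows "(e, f) \<in> gadj (line_graph1 D) \<longleftrightarrow> meets D e f"
proof -
  have "\<not> meets D e e"
    using meets_shape[OF assms] by (metis doubleton_eq_iff)
  then show ?thesis
    unfolding line_graph1_def meets_def ends_def by auto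
qed

lemma sgraph_iso_line_graph1:
  assumes "is_multigraph D" "is_multigraph D'"
  shows "sgraph_iso (line_graph1 D) (line_graph1 D') \<phi> \<longleftrightarrow>
    bij_betw \<phi> (edges D) (edges D') \<and>
    (\<forall>e\<in>edges D. \<forall>f\<in>edges D. meets D e f \<longleftrightarrow> meets D' (\<phi> e) (\<phi> f))"
  unfolding sgraph_iso_def by (simp add: gadj_line_graph1 assms)

lemma connected_is_multigraph: "connected_multigraph D \<Longrightarrow> is_multigraph D"
  by (simp add: connected_multigraph_def)

section \<open>Edges leaving a set of vertices\<close>

text \<open>A path from inside \<open>S\<close> to outside has a step that leaves \<open>S\<close>.
  When \<open>S\<close> consists of four vertices, excluding four-vertex graphs is what makes it a
  proper subset.\<close>

lemma leaving_edge:
  assumes D: "connected_multigraph D" and S: "S \<subseteq> verts D" "S \<noteq> {}" "S \<noteq> verts D"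
  obtains e x y where "e \<in> edges D" "ends D e = {x, y}" "x \<in> S" "y \<notin> S"
proof -
  obtain s t where st: "s \<in> S" "t \<in> verts D" "t \<notin> S"
    using S by blast
  then have "(adjacent D)\<^sup>*\<^sup>* s t"
    using D S unfolding connected_multigraph_def by blast
  \<comment> \<open>The induction runs along a path from \<open>s\<close>: the vertex reached is
    still in \<open>S\<close>, or some earlier step has left \<open>S\<close>.\<close>
  then have "t \<notin> S \<longrightarrow> (\<exists>x y. adjacent D x y \<and> x \<in> S \<and> y \<notin> S)"
    by (induction rule: rtranclp_induct) (use st in blast)+
  then obtain x y where xy: "adjacent D x y" "x \<in> S" "y \<notin> S"
    using st by blast
  then obtain e where e: "e \<in> edges D" "x \<in> ends D e" "y \<in> ends D e"
    unfolding adjacent_def ends_def by blast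
  then have "ends D e = {x, y}"
    using ends_eq_doubletonI[OF connected_is_multigraph[OF D] e] xy by blast
  then show thesis using that e xy by blast
qed

lemma edge_at_vertex:
  assumes D: "connected_multigraph D" and "v \<in> verts D" "verts D \<noteq> {v}"
  obtains e where "e \<in> edges D" "v \<in> ends D e"
proof -
  have "{v} \<subseteq> verts D" "{v} \<noteq> {}" "{v} \<noteq> verts D"
    using assms by auto
  then obtain e x y where "e \<in> edges D" "ends D e = {x, y}" "x \<in> {v}"
    using leaving_edge[OF D] by metis
  then show thesis
    using that by auto
qed

text \<open>The end \<open>y\<close> outside \<open>{a, b}\<close> prevents \<open>h\<close> and
  \<open>e\<close> from being parallel, so adjacency depends on \<open>x\<close> alone.\<close>

lemma meets_leaving_edge:
  assumes "h \<in> edges D" "ends D h = {x, y}" "e \<in> edges D" "ends D e = {a, b}" "a \<noteq> b"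
    and "y \<notin> {a, b}" "x \<noteq> y"
  shows "meets D h e \<longleftrightarrow> x \<in> {a, b}"
  using meets_doubleton[OF assms(1,3,2,4,7,5)] assms(6) by auto

section \<open>Recognising parallel edges and claws in the 1-line graph\<close>

text \<open>Non-adjacent edges with different ends are disjoint, and an edge leaving their four ends
  meets exactly one of them. On four vertices there is no such edge: opposite edges look like
  parallel ones. As \<open>card\<close> is 0 on infinite sets, infinite multi-graphs are
  included.\<close>

lemma parallel_iff:
  assumes D: "connected_multigraph D" and c: "card (verts D) \<noteq> 4"
    and E: "e \<in> edges D" "f \<in> edges D"
  shows "ends D e = ends D f \<longleftrightarrow>
    \<not> meets D e f \<and> (\<forall>h\<in>edges D. meets D h e \<longleftrightarrow> meets D h f)" (is "_ \<longleftrightarrow> ?R")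
proof
  note mg = connected_is_multigraph[OF D]
  assume eq: "ends D e = ends D f"
  have "\<not> meets D e f"
    using meets_shape[OF mg, of e f] eq by (metis doubleton_eq_iff)
  then show ?R
    using eq E unfolding meets_def by simp
next
  note mg = connected_is_multigraph[OF D]
  assume R: ?R
  obtain a b where ab: "a \<noteq> b" "ends D e = {a, b}" "a \<in> verts D" "b \<in> verts D"
    using ends_edge[OF mg E(1)] by metis
  obtain p q where pq: "p \<noteq> q" "ends D f = {p, q}" "p \<in> verts D" "q \<in> verts D"
    using ends_edge[OF mg E(2)] by metis
  show "ends D e = ends D f"
  proof (rule ccontr)
    assume "ends D e \<noteq> ends D f"
    then have disj: "{a, b} \<inter> {p, q} = {}"
      using meets_doubleton[OF E ab(2) pq(2) ab(1) pq(1)] conjunct1[OF R] ab(2) pq(2) by auto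
    then have "card {a, b, p, q} = 4"
      using ab(1) pq(1) by auto
    then have "{a, b, p, q} \<subseteq> verts D" "{a, b, p, q} \<noteq> {}" "{a, b, p, q} \<noteq> verts D"
      using c ab(3,4) pq(3,4) by auto
    then obtain h x y where h: "h \<in> edges D" "ends D h = {x, y}"
      "x \<in> {a, b, p, q}" "y \<notin> {a, b, p, q}"
      using leaving_edge[OF D] by metis
    then have "x \<noteq> y" by auto
    have "meets D h e \<longleftrightarrow> x \<in> {a, b}" "meets D h f \<longleftrightarrow> x \<in> {p, q}"
      using meets_leaving_edge[OF h(1,2) E(1) ab(2,1) _ \<open>x \<noteq> y\<close>]
        meets_leaving_edge[OF h(1,2) E(2) pq(2,1) _ \<open>x \<noteq> y\<close>] h(4) by auto
    then have "x \<in> {a, b} \<longleftrightarrow> x \<in> {p, q}"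
      using R h(1) by metis
    then show False
      using h(3) disj by blast
  qed
qed

text \<open>Iterated equivalence of three propositions says that an odd number of them holds.\<close>

lemma claw_iff:
  assumes D: "connected_multigraph D" and c: "card (verts D) \<noteq> 4"
    and ef: "meets D e f" and ge: "meets D g e" and gf: "meets D g f"
    and v: "v \<in> ends D e" "v \<in> ends D f"
  shows "v \<in> ends D g \<longleftrightarrow> (\<exists>h\<in>edges D. meets D h e \<longleftrightarrow> (meets D h f \<longleftrightarrow> meets D h g))"
proof -
  note mg = connected_is_multigraph[OF D]
  note E = meets_edges[OF ef] meets_edges(1)[OF ge]
  obtain a where a: "v \<noteq> a" "ends D e = {v, a}" "a \<in> verts D"
    using ends_edge_at[OF mg E(1) v(1)] by metis
  obtain b where b: "v \<noteq> b" "ends D f = {v, b}" "b \<in> verts D"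
    using ends_edge_at[OF mg E(2) v(2)] by metis
  have "v \<in> verts D"
    using ends_subset_verts[OF mg] v by blast
  have "a \<noteq> b"
    using meets_common_end_unique[OF ef, of v a] a(1,2) b(2) by auto
  show ?thesis
  proof
    assume "v \<in> ends D g"
    then obtain k where k: "v \<noteq> k" "ends D g = {v, k}" "k \<in> verts D"
      using ends_edge_at[OF mg E(3)] by metis
    have "k \<noteq> a" "k \<noteq> b"
      using meets_common_end_unique[OF ge, of v k] meets_common_end_unique[OF gf, of v k]
        a(2) b(2) k(1,2) by auto
    then have "card {v, a, b, k} = 4"
      using a(1) b(1) k(1) \<open>a \<noteq> b\<close> by auto
    then have "{v, a, b, k} \<subseteq> verts D" "{v, a, b, k} \<noteq> {}" "{v, a, b, k} \<noteq> verts D"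
      using c a(3) b(3) k(3) \<open>v \<in> verts D\<close> by auto
    then obtain h x y where h: "h \<in> edges D" "ends D h = {x, y}"
      "x \<in> {v, a, b, k}" "y \<notin> {v, a, b, k}"
      using leaving_edge[OF D] by metis
    then have "x \<noteq> y" by auto
    \<comment> \<open>At the centre \<open>v\<close> of the claw \<open>h\<close> meets all three
      edges, at one of the leaves exactly one.\<close>
    have "meets D h e \<longleftrightarrow> x \<in> {v, a}" "meets D h f \<longleftrightarrow> x \<in> {v, b}" "meets D h g \<longleftrightarrow> x \<in> {v, k}"
      using meets_leaving_edge[OF h(1,2) E(1) a(2,1) _ \<open>x \<noteq> y\<close>]
        meets_leaving_edge[OF h(1,2) E(2) b(2,1) _ \<open>x \<noteq> y\<close>]
        meets_leaving_edge[OF h(1,2) E(3) k(2,1) _ \<open>x \<noteq> y\<close>] h(4) by auto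
    then show "\<exists>h\<in>edges D. meets D h e \<longleftrightarrow> (meets D h f \<longleftrightarrow> meets D h g)"
      using h(1,3) a(1) b(1) k(1) \<open>a \<noteq> b\<close> \<open>k \<noteq> a\<close> \<open>k \<noteq> b\<close> by (intro bexI[of _ h]) auto
  next
    assume "\<exists>h\<in>edges D. meets D h e \<longleftrightarrow> (meets D h f \<longleftrightarrow> meets D h g)"
    then obtain h where h: "h \<in> edges D" "meets D h e \<longleftrightarrow> (meets D h f \<longleftrightarrow> meets D h g)"
      by blast
    show "v \<in> ends D g"
    proof (rule ccontr)
      assume "v \<notin> ends D g"
      \<comment> \<open>Avoiding \<open>v\<close>, the edge \<open>g\<close> can meet
        \<open>e\<close> only in \<open>a\<close> and \<open>f\<close> only in \<open>b\<close>, so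
        it closes a triangle.\<close>
      then have "a \<in> ends D g" "b \<in> ends D g"
        using meets_common_end[OF ge] meets_common_end[OF gf] a(2) b(2)
        by (metis insertE singletonD)+
      then have g: "ends D g = {a, b}"
        using ends_eq_doubletonI[OF mg E(3)] \<open>a \<noteq> b\<close> by blast
      obtain x y where xy: "x \<noteq> y" "ends D h = {x, y}"
        using ends_edge[OF mg h(1)] by metis
      \<comment> \<open>An edge parallel to a side of the triangle meets the other two sides, an
        edge on just one corner meets the two sides there, and any other edge meets none: the number
        is never odd.\<close>
      show False
        using h(2) meets_doubleton[OF h(1) E(1) xy(2) a(2) xy(1) a(1)]
          meets_doubleton[OF h(1) E(2) xy(2) b(2) xy(1) b(1)]
          meets_doubleton[OF h(1) E(3) xy(2) g xy(1) \<open>a \<noteq> b\<close>] a(1) b(1) \<open>a \<noteq> b\<close> xy(1)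
        unfolding doubleton_eq_iff by (smt (verit))
    qed
  qed
qed

text \<open>An edge on \<open>v\<close> is parallel to \<open>e\<close> or \<open>f\<close>, or
  forms a claw with them. By \<open>parallel_iff\<close> the right-hand side depends on the 1-line
  graph only, so two adjacent edges determine all edges on their common vertex.\<close>

lemma mem_ends_iff:
  assumes D: "connected_multigraph D" and c: "card (verts D) \<noteq> 4"
    and ef: "meets D e f" and g: "g \<in> edges D"
    and v: "v \<in> ends D e" "v \<in> ends D f"
  shows "v \<in> ends D g \<longleftrightarrow> ends D g = ends D e \<or> ends D g = ends D f \<or>
    meets D g e \<and> meets D g f \<and>
    (\<exists>h\<in>edges D. meets D h e \<longleftrightarrow> (meets D h f \<longleftrightarrow> meets D h g))"
  using claw_iff[OF D c ef _ _ v] meets_if_common_end[OF connected_is_multigraph[OF D] g]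
    meets_edges[OF ef] v by metis

section \<open>Multi-graphs with at least three vertices\<close>

text \<open>Adjacent edges span three vertices. Letting \<open>x\<close> and \<open>y\<close> range
  over equal vertices too, \<open>verts D \<noteq> {x, y}\<close> says that a nonempty vertex set
  has at least three elements, finite or not.\<close>

lemma meets_imp_verts_neq:
  assumes "is_multigraph D" "meets D e f"
  shows "verts D \<noteq> {x, y}"
proof -
  obtain v a b where s: "ends D e = {v, a}" "ends D f = {v, b}" "v \<noteq> a" "v \<noteq> b" "a \<noteq> b"
    using meets_shape[OF assms] by metis
  then have "{v, a, b} \<subseteq> verts D"
    using ends_subset_verts[OF assms(1), of e] ends_subset_verts[OF assms(1), of f] by auto
  then show ?thesis
    using s by auto
qed

lemma meeting_edge:
  assumes D: "connected_multigraph D" and e: "e \<in> edges D" and large: "\<And>x y. verts D \<noteq> {x, y}"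
  obtains f where "meets D e f"
proof -
  note mg = connected_is_multigraph[OF D]
  obtain a b where ab: "a \<noteq> b" "ends D e = {a, b}" "a \<in> verts D" "b \<in> verts D"
    using ends_edge[OF mg e] by metis
  have "{a, b} \<subseteq> verts D" "{a, b} \<noteq> {}" "{a, b} \<noteq> verts D"
    using ab large[of a b] by auto
  then obtain h x y where h: "h \<in> edges D" "ends D h = {x, y}" "x \<in> {a, b}" "y \<notin> {a, b}"
    using leaving_edge[OF D] by metis
  then have "meets D e h"
    by (intro meets_if_common_end[OF mg e h(1), of x]) (auto simp: ab)
  then show thesis using that by blast
qed

text \<open>If distinct \<open>v\<close> and \<open>w\<close> were on the same edges, an edge on
  \<open>v\<close> would join them, but an edge adjacent to that one is on only one of its
  ends.\<close>

lemma vertex_eqI: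
  assumes D: "connected_multigraph D" and large: "\<And>x y. verts D \<noteq> {x, y}"
    and v: "v \<in> verts D" and same: "\<And>g. g \<in> edges D \<Longrightarrow> v \<in> ends D g \<longleftrightarrow> w \<in> ends D g"
  shows "v = w"
proof (rule ccontr)
  assume "v \<noteq> w"
  note mg = connected_is_multigraph[OF D]
  have "verts D \<noteq> {v}" using large[of v v] by simp
  then obtain e where e: "e \<in> edges D" "v \<in> ends D e"
    using edge_at_vertex[OF D v] by metis
  then have "w \<in> ends D e" using same by blast
  then have ee: "ends D e = {v, w}"
    using ends_eq_doubletonI[OF mg e] \<open>v \<noteq> w\<close> by blast
  obtain f where f: "meets D e f"
    using meeting_edge[OF D e(1) large] by blast
  then show False
    using same[OF meets_edges(2)[OF f]] ee \<open>v \<noteq> w\<close> meets_common_end[OF f]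
      meets_common_end_unique[OF f] by (metis insertE insertI1 insertI2 singletonD singletonI)
qed

section \<open>Corresponding vertices under an isomorphism of 1-line graphs\<close>

locale line_graph1_iso =
  fixes D :: "('v, 'e) multigraph" and D' :: "('w, 'f) multigraph" and \<phi> :: "'e \<Rightarrow> 'f"
  assumes D: "connected_multigraph D" and D': "connected_multigraph D'"
    and card: "card (verts D) \<noteq> 4" and card': "card (verts D') \<noteq> 4"
    and bij: "bij_betw \<phi> (edges D) (edges D')"
    and meets_iff: "\<And>e f. \<lbrakk>e \<in> edges D; f \<in> edges D\<rbrakk> \<Longrightarrow> meets D' (\<phi> e) (\<phi> f) \<longleftrightarrow> meets D e f"
begin

lemmas mg = connected_is_multigraph[OF D]
lemmas mg' = connected_is_multigraph[OF D']

lemma image_edge: "e \<in> edges D \<Longrightarrow> \<phi> e \<in> edges D'"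
  using bij by (auto simp: bij_betw_def)

lemma edges_image: "edges D' = \<phi> ` edges D"
  using bij by (auto simp: bij_betw_def)

lemma parallel_image_iff:
  assumes "e \<in> edges D" "f \<in> edges D"
  shows "ends D' (\<phi> e) = ends D' (\<phi> f) \<longleftrightarrow> ends D e = ends D f"
  unfolding parallel_iff[OF D card assms] parallel_iff[OF D' card' image_edge image_edge, OF assms]
  using assms by (simp add: edges_image meets_iff)

text \<open>A relation rather than a map: existence of a partner, its uniqueness and injectivity are
  proved separately, from size conditions on different sides.\<close>

definition corr :: "'v \<Rightarrow> 'w \<Rightarrow> bool" where
  "corr v w \<longleftrightarrow> w \<in> verts D' \<and> (\<forall>g\<in>edges D. v \<in> ends D g \<longleftrightarrow> w \<in> ends D' (\<phi> g))"

text \<open>The partner is the common vertex of the image edges: \<open>mem_ends_iff\<close>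
  describes the edges on either vertex by the same condition on the 1-line graph.\<close>

lemma corr_branching_vertex:
  assumes ef: "meets D e f" and v: "v \<in> ends D e" "v \<in> ends D f"
  obtains w where "corr v w"
proof -
  note E = meets_edges[OF ef]
  have ef': "meets D' (\<phi> e) (\<phi> f)"
    using ef E meets_iff by simp
  then obtain w where w: "w \<in> ends D' (\<phi> e)" "w \<in> ends D' (\<phi> f)"
    using meets_common_end by metis
  have "v \<in> ends D g \<longleftrightarrow> w \<in> ends D' (\<phi> g)" if g: "g \<in> edges D" for g
    unfolding mem_ends_iff[OF D card ef g v] mem_ends_iff[OF D' card' ef' image_edge[OF g] w]
    using g E by (simp add: edges_image meets_iff parallel_image_iff)
  moreover have "w \<in> verts D'"
    using ends_subset_verts[OF mg'] w by blast
  ultimately show thesis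
    using that unfolding corr_def by blast
qed

text \<open>If no two adjacent edges share \<open>v\<close>, all edges on \<open>v\<close> are
  parallel and lead to a single neighbour \<open>u\<close>. This \<open>u\<close> lies on two
  adjacent edges and so has a partner \<open>u'\<close>; the partner of \<open>v\<close> is then the
  other end of the image of an edge on \<open>v\<close>.\<close>

lemma corr_vertex:
  assumes large: "\<And>x y. verts D \<noteq> {x, y}" and v: "v \<in> verts D"
  obtains w where "corr v w"
proof -
  have "verts D \<noteq> {v}" using large[of v v] by simp
  then obtain e where e: "e \<in> edges D" "v \<in> ends D e"
    using edge_at_vertex[OF D v] by metis
  obtain u where u: "v \<noteq> u" "ends D e = {v, u}"
    using ends_edge_at[OF mg e] by metis
  show thesis
  proof (cases "\<exists>f. meets D e f \<and> v \<in> ends D f")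
    case True
    then show ?thesis
      using corr_branching_vertex e that by metis
  next
    case leaf: False
    obtain f where f: "meets D e f"
      using meeting_edge[OF D e(1) large] by blast
    \<comment> \<open>No edge adjacent to \<open>e\<close> is on \<open>v\<close>, so all of them
      are on the other end \<open>u\<close>.\<close>
    have u_common: "u \<in> ends D f" if "meets D e f" for f
      using meets_common_end[OF that] that leaf u(2) by (metis insertE singletonD)
    obtain u' where u': "corr u u'"
      using corr_branching_vertex[OF f _ u_common[OF f]] u by auto
    then have "u' \<in> ends D' (\<phi> e)"
      using e u unfolding corr_def by auto
    then obtain w where w: "u' \<noteq> w" "ends D' (\<phi> e) = {u', w}" "w \<in> verts D'"
      using ends_edge_at[OF mg' image_edge[OF e(1)]] by metis
    have "v \<in> ends D g \<longleftrightarrow> w \<in> ends D' (\<phi> g)" if g: "g \<in> edges D" for g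
    proof -
      have "v \<in> ends D g \<longleftrightarrow> ends D e = ends D g"
        using meets_if_common_end[OF mg e(1) g e(2)] leaf e(2) by auto
      also have "\<dots> \<longleftrightarrow> ends D' (\<phi> e) = ends D' (\<phi> g)"
        using parallel_image_iff[OF e(1) g] by simp
      also have "\<dots> \<longleftrightarrow> w \<in> ends D' (\<phi> g)"
      proof
        \<comment> \<open>If not parallel to \<open>\<phi> e\<close>, the edge
          \<open>\<phi> g\<close> would be adjacent to it, so \<open>g\<close> would be on
          \<open>u\<close> and \<open>\<phi> g\<close> on \<open>u'\<close>; it would then share
          both \<open>u'\<close> and \<open>w\<close> with \<open>\<phi> e\<close>.\<close>
        assume wg: "w \<in> ends D' (\<phi> g)"
        show "ends D' (\<phi> e) = ends D' (\<phi> g)"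
        proof (rule ccontr)
          assume "ends D' (\<phi> e) \<noteq> ends D' (\<phi> g)"
          then have m: "meets D' (\<phi> e) (\<phi> g)"
            using meets_if_common_end[OF mg' image_edge[OF e(1)] image_edge[OF g] _ wg] w by auto
          then have "u \<in> ends D g"
            using u_common meets_iff[OF e(1) g] by blast
          then have "u' \<in> ends D' (\<phi> g)"
            using u' g unfolding corr_def by blast
          with wg w(1,2) show False
            using meets_common_end_unique[OF m, of u' w] by auto
        qed
      qed (use w in auto)
      finally show ?thesis .
    qed
    then show ?thesis
      using that w unfolding corr_def by blast
  qed
qed

lemma multigraph_iso_iff_corr:
  "multigraph_iso D D' fV \<phi> \<longleftrightarrow>
    bij_betw fV (verts D) (verts D') \<and> (\<forall>v\<in>verts D. corr v (fV v))"
proof -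
  have "fV v \<in> verts D'" if "bij_betw fV (verts D) (verts D')" "v \<in> verts D" for v
    using that by (rule bij_betwE[rule_format])
  then show ?thesis
    using bij unfolding multigraph_iso_def corr_def ends_def by auto
qed

lemma corr_unique:
  assumes "\<And>x y. verts D' \<noteq> {x, y}" "corr v w" "corr v w'"
  shows "w = w'"
  using assms(2,3) by (intro vertex_eqI[OF D' assms(1)]) (auto simp: corr_def edges_image)

lemma corr_injective:
  assumes "\<And>x y. verts D \<noteq> {x, y}" "corr v w" "corr v' w" "v \<in> verts D"
  shows "v = v'"
  using assms(2,3,4) by (intro vertex_eqI[OF D assms(1)]) (auto simp: corr_def)

text \<open>The situation is symmetric, so partners for the vertices of \<open>D'\<close>, and with
  them surjectivity, come from the results already proved for \<open>D\<close>.\<close>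

lemma inverse: "line_graph1_iso D' D (inv_into (edges D) \<phi>)"
proof
  let ?\<psi> = "inv_into (edges D) \<phi>"
  show "bij_betw ?\<psi> (edges D') (edges D)"
    using bij by (rule bij_betw_inv_into)
  fix e f assume "e \<in> edges D'" "f \<in> edges D'"
  then have "?\<psi> e \<in> edges D" "?\<psi> f \<in> edges D" "\<phi> (?\<psi> e) = e" "\<phi> (?\<psi> f) = f"
    unfolding edges_image by (simp_all add: inv_into_into f_inv_into_f)
  then show "meets D (?\<psi> e) (?\<psi> f) \<longleftrightarrow> meets D' e f"
    using meets_iff[of "?\<psi> e" "?\<psi> f"] by simp
qed (fact D D' card card')+

lemma corr_surjective:
  assumes large: "\<And>x y. verts D' \<noteq> {x, y}" and w: "w \<in> verts D'"
  obtains v where "v \<in> verts D" "corr v w"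
proof -
  interpret inv: line_graph1_iso D' D "inv_into (edges D) \<phi>"
    by (rule inverse)
  obtain v where v: "inv.corr w v"
    using inv.corr_vertex[OF large w] by metis
  have "v \<in> ends D g \<longleftrightarrow> w \<in> ends D' (\<phi> g)" if "g \<in> edges D" for g
    using v that bij image_edge[OF that] unfolding inv.corr_def
    by (metis bij_betw_inv_into_left)
  then show thesis
    using that v w unfolding inv.corr_def corr_def by blast
qed

lemma iso_exists_unique_large:
  assumes large: "\<And>x y. verts D \<noteq> {x, y}" and large': "\<And>x y. verts D' \<noteq> {x, y}"
  shows "\<exists>!fV. fV \<in> extensional (verts D) \<and> multigraph_iso D D' fV \<phi>"
proof
  \<comment> \<open>Restricting to \<open>verts D\<close> fixes the values elsewhere, so that
    uniqueness on vertices becomes equality of functions.\<close>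
  let ?f = "\<lambda>v\<in>verts D. SOME w. corr v w"
  have f: "corr v (?f v)" if "v \<in> verts D" for v
    using corr_vertex[OF large that] that by (metis restrict_apply' someI)
  have "?f ` verts D = verts D'"
  proof
    show "?f ` verts D \<subseteq> verts D'"
      using f unfolding corr_def by blast
    show "verts D' \<subseteq> ?f ` verts D"
    proof
      fix w assume "w \<in> verts D'"
      then obtain v where "v \<in> verts D" "corr v w"
        using corr_surjective[OF large'] by metis
      then show "w \<in> ?f ` verts D"
        using f corr_unique[OF large'] by blast
    qed
  qed
  moreover have "inj_on ?f (verts D)"
  proof (rule inj_onI)
    fix v v' assume v: "v \<in> verts D" "v' \<in> verts D" and eq: "?f v = ?f v'"
    show "v = v'"
      using corr_injective[OF large f[OF v(1), unfolded eq] f[OF v(2)] v(1)] .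
  qed
  ultimately show "?f \<in> extensional (verts D) \<and> multigraph_iso D D' ?f \<phi>"
    using f unfolding multigraph_iso_iff_corr bij_betw_def by auto
  fix g assume g: "g \<in> extensional (verts D) \<and> multigraph_iso D D' g \<phi>"
  show "g = ?f"
  proof (rule extensionalityI[of _ "verts D"])
    fix v assume "v \<in> verts D"
    then show "g v = ?f v"
      using f g corr_unique[OF large'] unfolding multigraph_iso_iff_corr by blast
  qed (use g in auto)
qed

section \<open>Multi-graphs with one or two vertices\<close>

text \<open>No edges of \<open>D\<close> are adjacent, hence none of \<open>D'\<close>. An edge of
  \<open>D'\<close> must then be on all its vertices, since an edge leaving its ends would be
  adjacent to it. Without edges, connectedness leaves a single vertex. So the presence of an edge
  tells two vertices from one.\<close>

lemma small_image:
  assumes "verts D = {x, y}"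
  obtains x' y' where "verts D' = {x', y'}" "x' = y' \<longleftrightarrow> x = y"
proof -
  have no_meets: "\<not> meets D e f" for e f
    using meets_imp_verts_neq[OF mg] assms by metis
  show thesis
  proof (cases "edges D' = {}")
    case True
    then have "edges D = {}"
      using edges_image by simp
    obtain w where w: "w \<in> verts D'"
      using D' unfolding connected_multigraph_def by blast
    then have "verts D' = {w}"
      using edge_at_vertex[OF D'] True by blast
    moreover have "verts D = {x}"
      using edge_at_vertex[OF D] \<open>edges D = {}\<close> assms by blast
    then have "x = y" using assms by auto
    ultimately show ?thesis
      using that[of w w] by simp
  next
    case False
    then obtain e where e: "e \<in> edges D"
      using edges_image by blast
    have "\<not> meets D' (\<phi> e) g" for g
      using no_meets meets_iff e meets_edges(2) edges_image by (metis imageE)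
    then obtain a b where ab: "verts D' = {a, b}"
      using meeting_edge[OF D' image_edge[OF e]] by metis
    have "x \<noteq> y"
      using ends_edge[OF mg e] assms by (metis insertE singletonD)
    moreover have "a \<noteq> b"
      using ends_edge[OF mg' image_edge[OF e]] ab by (metis insertE singletonD)
    ultimately show ?thesis
      using that ab by blast
  qed
qed

lemma iso_exists_unique_singleton:
  assumes "verts D = {x}"
  shows "\<exists>!fV. fV \<in> extensional (verts D) \<and> multigraph_iso D D' fV \<phi>"
proof -
  have "verts D = {x, x}"
    using assms by simp
  then obtain x' where x': "verts D' = {x'}"
    by (rule small_image) auto
  have "edges D = {}"
    using ends_edge[OF mg] assms by (metis all_not_in_conv singletonD)
  then have "corr x x'"
    using x' by (simp add: corr_def)
  then have "multigraph_iso D D' fV \<phi> \<longleftrightarrow> fV x = x'" for fV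
    unfolding multigraph_iso_iff_corr assms x' by (auto simp: bij_betw_def)
  then show ?thesis
    unfolding assms
    by (intro ex1I[of _ "\<lambda>v\<in>{x}. x'"]) (auto intro: extensionalityI[of _ "{x}"])
qed

text \<open>Every vertex is on every edge, so any bijection of the vertices works.\<close>

lemma iso_exists_doubleton:
  assumes "verts D = {x, y}" "x \<noteq> y"
  shows "\<exists>fV. multigraph_iso D D' fV \<phi>"
proof -
  obtain x' y' where xy': "verts D' = {x', y'}" "x' \<noteq> y'"
    using small_image[OF assms(1)] assms(2) by metis
  have all: "ends D e = {x, y}" if "e \<in> edges D" for e
    using ends_edge[OF mg that] assms by (metis insertE insert_commute singletonD)
  have all': "ends D' e = {x', y'}" if "e \<in> edges D'" for e
    using ends_edge[OF mg' that] xy' by (metis insertE insert_commute singletonD)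
  have "multigraph_iso D D' (\<lambda>v. if v = x then x' else y') \<phi>"
    unfolding multigraph_iso_iff_corr assms(1) corr_def using assms(2) xy' all all' image_edge
    by (auto simp: bij_betw_def)
  then show ?thesis by blast
qed

section \<open>From isomorphisms of 1-line graphs to isomorphisms of multi-graphs\<close>

lemma iso_exists_and_unique:
  "(\<exists>fV. multigraph_iso D D' fV \<phi>) \<and>
   (card (verts D) \<noteq> 2 \<longrightarrow> (\<exists>!fV. fV \<in> extensional (verts D) \<and> multigraph_iso D D' fV \<phi>))"
proof (cases "\<exists>x y. verts D = {x, y}")
  case True
  then obtain x y where xy: "verts D = {x, y}" by blast
  show ?thesis
  proof (cases "x = y")
    case True
    then show ?thesis
      using iso_exists_unique_singleton[of x] xy by auto
  next
    case False
    then show ?thesis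
      using iso_exists_doubleton xy by simp
  qed
next
  case False
  interpret inv: line_graph1_iso D' D "inv_into (edges D) \<phi>"
    by (rule inverse)
  \<comment> \<open>If \<open>D'\<close> had at most two vertices, so would \<open>D\<close>, by
    \<open>small_image\<close> for the inverse isomorphism.\<close>
  have "verts D' \<noteq> {x, y}" for x y
    using inv.small_image False by metis
  then show ?thesis
    using iso_exists_unique_large False by blast
qed

end

lemma line_graph1_isoI:
  assumes "connected_multigraph D" "connected_multigraph D'"
    and "card (verts D) \<noteq> 4" "card (verts D') \<noteq> 4"
    and "sgraph_iso (line_graph1 D) (line_graph1 D') \<phi>"
  shows "line_graph1_iso D D' \<phi>"
  using assms by unfold_locales (auto simp: sgraph_iso_line_graph1 connected_is_multigraph)

lemma sgraph_isomorphic_refl: "sgraph_isomorphic G G"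
  unfolding sgraph_isomorphic_def sgraph_iso_def by (intro exI[of _ id]) auto

lemma multigraph_isomorphic_if_line_graph1_isomorphic:
  assumes "connected_multigraph D" "connected_multigraph D'"
    and "card (verts D) \<noteq> 4" "card (verts D') \<noteq> 4"
    and "sgraph_isomorphic (line_graph1 D) (line_graph1 D')"
  shows "multigraph_isomorphic D D'"
  using line_graph1_iso.iso_exists_and_unique[OF line_graph1_isoI[OF assms(1-4)]] assms(5)
  unfolding sgraph_isomorphic_def multigraph_isomorphic_def by blast

section \<open>Reducing four vertices to three\<close>

text \<open>An edge off \<open>d\<close> keeps its ends, while an edge on \<open>d\<close> receives
  the complement of its ends. On four vertices this complement is again a pair.\<close>

definition fold_vertex :: "'v \<Rightarrow> ('v, 'e) multigraph \<Rightarrow> ('v, 'e) multigraph" where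
  "fold_vertex d D = \<lparr> verts = verts D - {d}, edges = edges D,
     inc = {(v, e). e \<in> edges D \<and> v \<in> verts D - {d} \<and> ((v, e) \<in> inc D \<longleftrightarrow> (d, e) \<notin> inc D)} \<rparr>"

text \<open>On four vertices, edges are non-adjacent iff their pairs of ends are equal or
  complementary. Folding makes complementary pairs equal, and on three vertices only parallel edges
  are non-adjacent.\<close>

lemma fold_vertex_four:
  assumes D: "connected_multigraph D" and V: "verts D = {a, b, c, d}"
    and dist: "distinct [a, b, c, d]"
  shows "connected_multigraph (fold_vertex d D)"
    and "line_graph1 (fold_vertex d D) = line_graph1 D"
proof -
  let ?F = "fold_vertex d D"
  note mg = connected_is_multigraph[OF D]
  have ends_fold: "ends ?F e =
      (if d \<in> ends D e then {a, b, c} - ends D e else {a, b, c} \<inter> ends D e)"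
    if "e \<in> edges D" for e
    using that V dist unfolding ends_def fold_vertex_def by auto
  have ends_cases: "ends D e \<in> {{a, b}, {a, c}, {b, c}, {a, d}, {b, d}, {c, d}}"
    if e: "e \<in> edges D" for e
  proof -
    obtain x y where "x \<noteq> y" "ends D e = {x, y}" "x \<in> {a, b, c, d}" "y \<in> {a, b, c, d}"
      using ends_edge[OF mg e] V by metis
    then show ?thesis by (auto simp: insert_commute)
  qed
  \<comment> \<open>The six pairs of vertices form three complementary couples, and each couple is
    folded onto its member without \<open>d\<close>.\<close>
  have fold_cases:
    "ends D e = {a, b} \<and> ends ?F e = {a, b} \<or> ends D e = {c, d} \<and> ends ?F e = {a, b} \<or>
     ends D e = {a, c} \<and> ends ?F e = {a, c} \<or> ends D e = {b, d} \<and> ends ?F e = {a, c} \<or>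
     ends D e = {b, c} \<and> ends ?F e = {b, c} \<or> ends D e = {a, d} \<and> ends ?F e = {b, c}" if e: "e \<in> edges D" for e
  proof -
    have "ends ?F e = {a, b}" if "ends D e = {a, b} \<or> ends D e = {c, d}"
      using that dist ends_fold[OF e] by (elim disjE) auto
    moreover have "ends ?F e = {a, c}" if "ends D e = {a, c} \<or> ends D e = {b, d}"
      using that dist ends_fold[OF e] by (elim disjE) auto
    moreover have "ends ?F e = {b, c}" if "ends D e = {b, c} \<or> ends D e = {a, d}"
      using that dist ends_fold[OF e] by (elim disjE) auto
    ultimately show ?thesis
      using ends_cases[OF e] unfolding insert_iff empty_iff by argo
  qed
  have mgF: "is_multigraph ?F"
    unfolding is_multigraph_def
  proof
    show "inc ?F \<subseteq> verts ?F \<times> edges ?F"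
      by (auto simp: fold_vertex_def)
    show "\<forall>e\<in>edges ?F. \<exists>v w. v \<noteq> w \<and> {u. (u, e) \<in> inc ?F} = {v, w}"
    proof
      fix e assume "e \<in> edges ?F"
      then have "ends ?F e \<in> {{a, b}, {a, c}, {b, c}}"
        using fold_cases[of e] by (auto simp: fold_vertex_def)
      then have "\<exists>v w. v \<noteq> w \<and> ends ?F e = {v, w}"
        using dist by auto
      then show "\<exists>v w. v \<noteq> w \<and> {u. (u, e) \<in> inc ?F} = {v, w}"
        unfolding ends_def .
    qed
  qed
  have edgesF: "edges ?F = edges D" and vertsF: "verts ?F = {a, b, c}"
    using V dist by (auto simp: fold_vertex_def)
  have neqs: "a \<noteq> b" "a \<noteq> c" "a \<noteq> d" "b \<noteq> c" "b \<noteq> d" "c \<noteq> d"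
    "b \<noteq> a" "c \<noteq> a" "d \<noteq> a" "c \<noteq> b" "d \<noteq> b" "d \<noteq> c"
    using dist by auto
  \<comment> \<open>The six positions of each edge give 36 cases, in which adjacency is computed
    before and after folding.\<close>
  have meets_fold: "meets ?F e f \<longleftrightarrow> meets D e f" if E: "e \<in> edges D" "f \<in> edges D" for e f
    using fold_cases[OF E(1)] fold_cases[OF E(2)]
    unfolding meets_iff_ends[OF mg E] meets_iff_ends[OF mgF E[folded edgesF]]
    by (elim disjE conjE)
      (simp_all only: neqs doubleton_eq_iff Int_insert_left insert_iff empty_iff simp_thms
        if_True if_False Int_empty_left insert_not_empty)
  have meets_eq: "meets ?F e f \<longleftrightarrow> meets D e f" for e f
    using meets_fold meets_edges[of ?F e f] meets_edges[of D e f] edgesF by blast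
  show "line_graph1 ?F = line_graph1 D"
  proof (rule sgraph.equality)
    show "gadj (line_graph1 ?F) = gadj (line_graph1 D)"
      using gadj_line_graph1[OF mgF] gadj_line_graph1[OF mg] meets_eq by auto
  qed (simp_all add: edgesF line_graph1_def)
  show "connected_multigraph ?F"
  proof -
    have large: "verts D \<noteq> {x, y}" for x y
      using V neqs by auto
    have "a \<in> verts D" "verts D \<noteq> {a}"
      using V neqs by auto
    then obtain e where e: "e \<in> edges D"
      using edge_at_vertex[OF D] by blast
    obtain f where f: "meets D e f"
      using meeting_edge[OF D e large] by blast
    \<comment> \<open>Two adjacent edges stay adjacent after folding. They span three vertices,
      which are all of them, and their common end \<open>v\<close> links the other two.\<close>
    then have "meets ?F e f" using meets_eq by simp
    then obtain v p q where s: "ends ?F e = {v, p}" "ends ?F f = {v, q}"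
      "v \<noteq> p" "v \<noteq> q" "p \<noteq> q"
      using meets_shape[OF mgF] by metis
    have "{v, p, q} \<subseteq> {a, b, c}"
      using ends_subset_verts[OF mgF, of e] ends_subset_verts[OF mgF, of f] s vertsF by auto
    then have vpq: "verts ?F = {v, p, q}"
      using s(3-5) vertsF by auto
    have adj: "adjacent ?F v p" "adjacent ?F p v" "adjacent ?F v q" "adjacent ?F q v"
      using s e meets_edges(2)[OF f] edgesF unfolding adjacent_def ends_def by blast+
    then have "(adjacent ?F)\<^sup>*\<^sup>* x v \<and> (adjacent ?F)\<^sup>*\<^sup>* v x" if "x \<in> verts ?F" for x
      using that vpq by auto
    then show ?thesis
      using mgF vpq unfolding connected_multigraph_def by (metis insert_not_empty rtranclp_trans)
  qed
qed

lemma line_graph1_not_four_vertices: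
  fixes D :: "('v, 'e) multigraph"
  assumes D: "connected_multigraph D"
  obtains D'' :: "('v, 'e) multigraph" where "connected_multigraph D''" "card (verts D'') \<noteq> 4"
    "line_graph1 D'' = line_graph1 D"
proof (cases "card (verts D) = 4")
  case True
  then obtain a b c d where abcd: "verts D = {a, b, c, d}" "distinct [a, b, c, d]"
    by (auto simp: card_Suc_eq numeral_eq_Suc)
  have "card (verts (fold_vertex d D)) = 3"
    using True abcd by (simp add: fold_vertex_def)
  then show thesis
    using fold_vertex_four[OF D abcd] that by simp
qed (use D that in blast)

theorem theorem1p2:
  fixes D :: "('v, 'e) multigraph" and D' :: "('w, 'f) multigraph" and \<phi> :: "'e \<Rightarrow> 'f"
  assumes "connected_multigraph D" and "connected_multigraph D'"
    and "sgraph_iso (line_graph1 D) (line_graph1 D') \<phi>"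
  shows "(card (verts D) \<noteq> 4 \<and> card (verts D') \<noteq> 4 \<longrightarrow>
            (\<exists>\<phi>V. multigraph_iso D D' \<phi>V \<phi>) \<and>
            (card (verts D) \<noteq> 2 \<longrightarrow>
              (\<exists>!\<phi>V. \<phi>V \<in> extensional (verts D) \<and> multigraph_iso D D' \<phi>V \<phi>)))
       \<and> (\<exists>D'' :: ('v, 'e) multigraph.
            (connected_multigraph D'' \<and> card (verts D'') \<noteq> 4 \<and>
             sgraph_isomorphic (line_graph1 D'') (line_graph1 D) \<and>
             sgraph_isomorphic (line_graph1 D'') (line_graph1 D')) \<and>
            (\<forall>H :: ('x, 'y) multigraph.
               connected_multigraph H \<and> card (verts H) \<noteq> 4 \<and>
               sgraph_isomorphic (line_graph1 H) (line_graph1 D) \<and>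
               sgraph_isomorphic (line_graph1 H) (line_graph1 D') \<longrightarrow>
               multigraph_isomorphic H D''))"
proof
  show "card (verts D) \<noteq> 4 \<and> card (verts D') \<noteq> 4 \<longrightarrow>
            (\<exists>\<phi>V. multigraph_iso D D' \<phi>V \<phi>) \<and>
            (card (verts D) \<noteq> 2 \<longrightarrow>
              (\<exists>!\<phi>V. \<phi>V \<in> extensional (verts D) \<and> multigraph_iso D D' \<phi>V \<phi>))"
    using line_graph1_iso.iso_exists_and_unique[OF line_graph1_isoI[OF assms(1,2) _ _ assms(3)]]
    by blast
  obtain D'' :: "('v, 'e) multigraph" where D'': "connected_multigraph D''"
    "card (verts D'') \<noteq> 4" "line_graph1 D'' = line_graph1 D"
    using line_graph1_not_four_vertices[OF assms(1)] by metis
  \<comment> \<open>Neither \<open>H\<close> nor \<open>D''\<close> has four vertices, so an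
    isomorphism of their 1-line graphs is induced by one of the multi-graphs.\<close>
  have "multigraph_isomorphic H D''"
    if "connected_multigraph H" "card (verts H) \<noteq> 4"
      "sgraph_isomorphic (line_graph1 H) (line_graph1 D)" for H :: "('x, 'y) multigraph"
    using multigraph_isomorphic_if_line_graph1_isomorphic[OF that(1) D''(1) that(2) D''(2)]
      that(3) D''(3) by simp
  moreover have "sgraph_isomorphic (line_graph1 D'') (line_graph1 D')"
    using assms(3) D''(3) unfolding sgraph_isomorphic_def by auto
  ultimately show "\<exists>D'' :: ('v, 'e) multigraph.
            (connected_multigraph D'' \<and> card (verts D'') \<noteq> 4 \<and>
             sgraph_isomorphic (line_graph1 D'') (line_graph1 D) \<and>
             sgraph_isomorphic (line_graph1 D'') (line_graph1 D')) \<and>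
            (\<forall>H :: ('x, 'y) multigraph.
               connected_multigraph H \<and> card (verts H) \<noteq> 4 \<and>
               sgraph_isomorphic (line_graph1 H) (line_graph1 D) \<and>
               sgraph_isomorphic (line_graph1 H) (line_graph1 D') \<longrightarrow>
               multigraph_isomorphic H D'')"
    using D'' sgraph_isomorphic_refl by metis
qed

end
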